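(* Fix $L\ge 0$ and $g(x)=\frac{L}{2}\|x\|^2$ on $\mathbb{R}^d$ ($d\ge 1$), and let $\sigma\ge 0$. For any $T\ge 1$ and any sequence of stepsizes $\gamma_0,\dots,\gamma_{T-1}>0$, there exists a difference-of-convex function $f=g-h$ with $$h(x)=\frac{a}{2}\|x\|^2,\qquad a:=\max_{0\le k<T}\Big(2L+\frac{1}{\gamma_k}\Big),$$ and a stochastic gradient oracle $\nabla h(x,\xi):=\nabla h(x)+\xi$, $\xi\sim\mathcal{N}(0,\sigma^2 I_d)$, such that: (i) the oracle is unbiased with uniformly bounded variance (property (BV) of the context), but it does not have uniformly bounded second moment (property (BS) of the context fails); (ii) for every starting point $x_0\in\mathbb{R}^d$, the sequence $x_1,\dots,x_T$ generated by the momentum-free stochastic proximal DC algorithm with exact subproblem solves (defined in the context) satisfies $$\mathbb{E}\big[\|\nabla f(x_k)\|^2\big]\ge\sigma^2\qquad\text{for all }1\le k\le T.$$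
   Context: Momentum-free stochastic proximal DC algorithm with exact subproblem solves: given $x_0\in\mathbb{R}^d$ and stepsizes $\gamma_t>0$, for $t=0,\dots,T-1$ draw $\xi_t$ (i.i.d., $\xi_t$ independent of $x_0,\dots,x_t$), and set $$x_{t+1}=\arg\min_{x\in\mathbb{R}^d}\Big\{g(x)+\frac{1}{2\gamma_t}\|x-x_t\|^2-\langle \nabla h(x_t,\xi_t),x-x_t\rangle\Big\}.$$ Properties of a stochastic gradient oracle $\nabla h(x,\xi)$ of a smooth convex function $h$: (BV) $h$ has Lipschitz gradient, $\mathbb{E}[\nabla h(x,\xi)]=\nabla h(x)$ for all $x$, and there is a finite constant $V$ with $\mathbb{E}\|\nabla h(x,\xi)-\nabla h(x)\|^2\le V$ for all $x\in\mathbb{R}^d$. (BS) $\mathbb{E}[\nabla h(x,\xi)]=\nabla h(x)$ for all $x$, and there is a finite constant $M\ge 0$ with $\mathbb{E}\|\nabla h(x,\xi)\|^2\le M^2$ for all $x\in\mathbb{R}^d$. *)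

theory Defs
  imports "HOL-Probability.Probability"
begin

definition gradient :: "('a::real_inner \<Rightarrow> real) \<Rightarrow> 'a \<Rightarrow> 'a" where
  "gradient f x = (THE D. GDERIV f x :> D)"

definition everywhere_differentiable :: "('a::real_inner \<Rightarrow> real) \<Rightarrow> bool" where
  "everywhere_differentiable f \<longleftrightarrow> (\<forall>x. \<exists>D. GDERIV f x :> D)"

definition lipschitz_gradient :: "('a::real_inner \<Rightarrow> real) \<Rightarrow> bool" where
  "lipschitz_gradient f \<longleftrightarrow>
     everywhere_differentiable f \<and> (\<exists>K. K-lipschitz_on UNIV (gradient f))"

definition dc_decomposition ::
    "('a::real_inner \<Rightarrow> real) \<Rightarrow> ('a \<Rightarrow> real) \<Rightarrow> ('a \<Rightarrow> real) \<Rightarrow> bool" where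
  "dc_decomposition f g h \<longleftrightarrow>
     convex_on UNIV g \<and> convex_on UNIV h \<and> f = (\<lambda>x. g x - h x)"

text \<open>
  A stochastic oracle for the gradient of \<open>h\<close> consists of the law \<open>N\<close> of the noise and a
  map \<open>G\<close>, where \<open>G x \<xi>\<close> is the stochastic gradient at the point \<open>x\<close> for the noise value
  \<open>\<xi>\<close>.  Expectations of squared norms are Lebesgue integrals with values in the extended
  nonnegative reals: the Bochner integral is 0 on non-integrable functions, so an upper bound
  on it would also hold when the second moment is infinite.
\<close>

definition unbiased_oracle ::
    "'s measure \<Rightarrow> ('a::euclidean_space \<Rightarrow> 's \<Rightarrow> 'a) \<Rightarrow> ('a \<Rightarrow> real) \<Rightarrow> bool" where
  "unbiased_oracle N G h \<longleftrightarrow>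
     (\<forall>x. integrable N (G x) \<and> (\<integral>\<xi>. G x \<xi> \<partial>N) = gradient h x)"

definition oracle_BV ::
    "'s measure \<Rightarrow> ('a::euclidean_space \<Rightarrow> 's \<Rightarrow> 'a) \<Rightarrow> ('a \<Rightarrow> real) \<Rightarrow> bool" where
  "oracle_BV N G h \<longleftrightarrow>
     lipschitz_gradient h \<and> unbiased_oracle N G h \<and>
     (\<exists>V\<ge>0. \<forall>x. (\<integral>\<^sup>+\<xi>. ennreal ((norm (G x \<xi> - gradient h x))\<^sup>2) \<partial>N) \<le> ennreal V)"

definition oracle_BS ::
    "'s measure \<Rightarrow> ('a::euclidean_space \<Rightarrow> 's \<Rightarrow> 'a) \<Rightarrow> ('a \<Rightarrow> real) \<Rightarrow> bool" where
  "oracle_BS N G h \<longleftrightarrow>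
     everywhere_differentiable h \<and> unbiased_oracle N G h \<and>
     (\<exists>M\<ge>0. \<forall>x. (\<integral>\<^sup>+\<xi>. ennreal ((norm (G x \<xi>))\<^sup>2) \<partial>N) \<le> ennreal (M\<^sup>2))"

text \<open>
  The normal law with mean 0 and covariance \<open>\<sigma>\<^sup>2 I\<close>, as the law of \<open>\<sigma> Z\<close> for a vector \<open>Z\<close>
  of independent standard normal coordinates.  For \<open>\<sigma> = 0\<close>, where there is no density, it is
  the point mass at 0.
\<close>

definition isotropic_normal :: "real \<Rightarrow> (real ^ 'n::finite) measure" where
  "isotropic_normal \<sigma> =
     distr (\<Pi>\<^sub>M i\<in>(UNIV :: 'n set). density lborel (\<lambda>z. ennreal (std_normal_density z)))
       borel (\<lambda>z. \<chi> i. \<sigma> * z i)"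

lemma sets_isotropic_normal [simp, measurable_cong]: "sets (isotropic_normal \<sigma>) = sets borel"
  by (simp add: isotropic_normal_def)

lemma prob_space_isotropic_normal: "prob_space (isotropic_normal \<sigma> :: (real ^ 'n::finite) measure)"
proof -
  let ?D = "density lborel (\<lambda>z. ennreal (std_normal_density z))"
  interpret D: prob_space ?D
    by (rule prob_space_normal_density) simp
  interpret P: prob_space "\<Pi>\<^sub>M i\<in>(UNIV :: 'n set). ?D"
    by (rule prob_space_PiM) (rule D.prob_space_axioms)
  have "(\<lambda>z. \<chi> i. \<sigma> * z i) \<in> borel_measurable (\<Pi>\<^sub>M i\<in>(UNIV :: 'n set). ?D)"
  proof (subst borel_measurable_euclidean_space, rule ballI)
    fix b :: "real ^ 'n" assume "b \<in> Basis"
    then obtain j where "b = axis j 1"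
      by (auto simp: Basis_vec_def)
    moreover have "(\<lambda>z. \<sigma> * z j) \<in> borel_measurable (\<Pi>\<^sub>M i\<in>(UNIV :: 'n set). ?D)"
      by measurable
    ultimately show "(\<lambda>z. (\<chi> i. \<sigma> * z i) \<bullet> b) \<in> borel_measurable (\<Pi>\<^sub>M i\<in>(UNIV :: 'n set). ?D)"
      by (simp add: inner_axis)
  qed
  then show ?thesis
    unfolding isotropic_normal_def by (rule P.prob_space_distr)
qed

definition iid_sample ::
    "'w measure \<Rightarrow> 's measure \<Rightarrow> nat \<Rightarrow> (nat \<Rightarrow> 'w \<Rightarrow> 's) \<Rightarrow> bool" where
  "iid_sample \<Omega> N T \<xi> \<longleftrightarrow>
     prob_space \<Omega> \<and> prob_space.indep_vars \<Omega> (\<lambda>_. N) \<xi> {..<T} \<and>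
     (\<forall>t<T. distr \<Omega> N (\<xi> t) = N)"

text \<open>
  The iterates for one realisation \<open>\<xi> 0, \<xi> 1, \<dots>\<close> of the noise.  The iterate with index \<open>t\<close>
  is a function of the deterministic starting point and of \<open>\<xi> 0, \<dots>, \<xi> (t - 1)\<close> only, so for an
  i.i.d. noise sequence \<open>\<xi> t\<close> is independent of the iterates up to \<open>t\<close>.  For convex \<open>g\<close> and
  positive stepsizes the objective of the subproblem is strongly convex, so its minimiser
  exists and is unique, and the choice made by \<^const>\<open>arg_min\<close> is immaterial.
\<close>

primrec spdca ::
    "('a::real_inner \<Rightarrow> real) \<Rightarrow> ('a \<Rightarrow> 's \<Rightarrow> 'a) \<Rightarrow> (nat \<Rightarrow> real) \<Rightarrow> 'a \<Rightarrow> (nat \<Rightarrow> 's) \<Rightarrow> nat \<Rightarrow> 'a"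
where
  "spdca g G \<gamma> x0 \<xi> 0 = x0"
| "spdca g G \<gamma> x0 \<xi> (Suc t) =
     (let y = spdca g G \<gamma> x0 \<xi> t in
      arg_min (\<lambda>x. g x + 1 / (2 * \<gamma> t) * (norm (x - y))\<^sup>2 - G y (\<xi> t) \<bullet> (x - y)) (\<lambda>_. True))"

end

(*
  The gradient of f at x is (L - a) x, and completing the square shows that one step is
  x_{t+1} = ((1/gamma_t + a) x_t + xi_t) / (L + 1/gamma_t).  Since a - L >= L + 1/gamma_t,
  the gradient at x_{t+1} has norm at least that of (1/gamma_t + a) x_t + xi_t.  As xi_t is
  centred and independent of x_t, the second moment of the latter is at least that of one
  coordinate of xi_t, namely sigma^2.
*)
theory Submission
  imports Defs
begin

section \<open>Calculus and convexity of multiples of the squared norm\<close>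

lemma gradient_eqI:
  assumes "GDERIV f x :> D"
  shows "gradient f x = D"
  unfolding gradient_def
proof (rule the_equality)
  fix D' assume "GDERIV f x :> D'"
  then have "(\<lambda>h. h \<bullet> D') = (\<lambda>h. h \<bullet> D)"
    using assms unfolding gderiv_def by (rule has_derivative_unique)
  then show "D' = D"
    by (metis vector_eq_ldot)
qed fact

lemma GDERIV_half_norm_sq:
  fixes x :: "'a::real_inner"
  shows "GDERIV (\<lambda>x. q / 2 * (norm x)\<^sup>2) x :> q *\<^sub>R x"
  unfolding gderiv_def power2_norm_eq_inner
  by (auto intro!: derivative_eq_intros simp: inner_commute algebra_simps)

lemma gradient_half_norm_sq:
  "gradient (\<lambda>x::'a::real_inner. q / 2 * (norm x)\<^sup>2) = (\<lambda>x. q *\<^sub>R x)"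
  by (intro ext gradient_eqI GDERIV_half_norm_sq)

lemma lipschitz_gradient_half_norm_sq:
  "lipschitz_gradient (\<lambda>x::'a::real_inner. q / 2 * (norm x)\<^sup>2)"
proof -
  have "\<bar>q\<bar>-lipschitz_on UNIV (\<lambda>x::'a. q *\<^sub>R x)"
    by (rule lipschitz_onI) (simp_all add: dist_norm flip: scaleR_diff_right)
  then show ?thesis
    unfolding lipschitz_gradient_def everywhere_differentiable_def gradient_half_norm_sq
    using GDERIV_half_norm_sq by blast
qed

lemma convex_on_half_norm_sq:
  assumes "q \<ge> 0"
  shows "convex_on UNIV (\<lambda>x::'a::real_inner. q / 2 * (norm x)\<^sup>2)"
proof -
  have "convex_on UNIV (\<lambda>x::'a. (norm x)\<^sup>2)"
  proof (rule convex_onI)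
    fix t :: real and x y :: 'a
    assume t: "0 < t" "t < 1"
    \<comment> \<open>The convexity gap of the squared norm is computed exactly; its nonnegativity
      is then visible.\<close>
    have "(1 - t) * (norm x)\<^sup>2 + t * (norm y)\<^sup>2 - (norm ((1 - t) *\<^sub>R x + t *\<^sub>R y))\<^sup>2
        = t * (1 - t) * (norm (x - y))\<^sup>2"
      unfolding power2_norm_eq_inner
      by (simp add: inner_simps inner_commute algebra_simps)
    moreover have "t * (1 - t) * (norm (x - y))\<^sup>2 \<ge> 0"
      using t by simp
    ultimately show "(norm ((1 - t) *\<^sub>R x + t *\<^sub>R y))\<^sup>2 \<le> (1 - t) * (norm x)\<^sup>2 + t * (norm y)\<^sup>2"
      by linarith
  qed simp
  then show ?thesis
    using assms by (intro convex_on_cmul) auto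
qed

section \<open>Closed form of the proximal step\<close>

lemma arg_min_dist_sq:
  fixes k :: "'a::real_normed_vector"
  assumes "c > 0" and F: "\<And>x. F x = m + c * (norm (x - k))\<^sup>2"
  shows "arg_min F (\<lambda>_. True) = (k :: 'a)"
proof -
  \<comment> \<open>Since \<open>arg_min\<close> is a choice among minimisers, only the objective
    values are known to agree at first. As \<open>c > 0\<close>, equal values force the distance to
    \<open>k\<close> to vanish.\<close>
  have "F (arg_min F (\<lambda>_. True)) = F k"
    using \<open>c > 0\<close> by (intro arg_min_equality) (auto simp: F)
  then show ?thesis
    using \<open>c > 0\<close> by (simp add: F)
qed

text \<open>Completing the square: the objective is quadratic with curvature
  \<open>L + 1 / \<gamma>\<close>, and the right-hand side is its stationary point.\<close>

lemma arg_min_quadratic_subproblem: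
  fixes y u :: "'a::real_inner"
  assumes "L \<ge> 0" and "\<gamma> > 0"
  shows "arg_min (\<lambda>x. L / 2 * (norm x)\<^sup>2 + 1 / (2 * \<gamma>) * (norm (x - y))\<^sup>2 - u \<bullet> (x - y))
      (\<lambda>_. True) = (1 / (L + 1 / \<gamma>)) *\<^sub>R ((1 / \<gamma>) *\<^sub>R y + u)" (is "arg_min ?F _ = ?k")
proof -
  define p where "p = L + 1 / \<gamma>"
  define k where "k = ?k"
  have p: "p > 0"
    using assms by (auto simp: p_def intro: add_nonneg_pos)
  have "p *\<^sub>R k = (1 / \<gamma>) *\<^sub>R y + u"
    using p by (simp add: k_def p_def)
  \<comment> \<open>Stationarity is used to eliminate \<open>u\<close>, and below \<open>L\<close>
    is replaced by \<open>p - 1 / \<gamma>\<close>. The completed square then becomes a polynomial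
    identity in \<open>p\<close>, \<open>s\<close> and inner products, with no division by
    \<open>p\<close>.\<close>
  then have u: "u = p *\<^sub>R k - (1 / \<gamma>) *\<^sub>R y"
    by simp
  have L: "L = p - 1 / \<gamma>"
    by (simp add: p_def)
  have g: "1 / (2 * \<gamma>) = (1 / \<gamma>) / 2"
    by simp
  define s where "s = 1 / \<gamma>"
  have "?F x = (?F k) + p / 2 * (norm (x - k))\<^sup>2" for x
    unfolding u L g power2_norm_eq_inner s_def[symmetric]
    by (simp add: inner_simps inner_commute field_simps)
  then have "arg_min ?F (\<lambda>_. True) = k"
    by (rule arg_min_dist_sq[rotated]) (use p in simp)
  then show ?thesis
    by (simp add: k_def)
qed

section \<open>Moments of the Gaussian noise\<close>

abbreviation std_normal_law :: "real measure" where
  "std_normal_law \<equiv> density lborel (\<lambda>z. ennreal (std_normal_density z))"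

lemma has_bochner_integral_std_normal_law:
  assumes "has_bochner_integral lborel (\<lambda>z. std_normal_density z * f z) (m :: real)"
    and [measurable]: "f \<in> borel_measurable borel"
  shows "has_bochner_integral std_normal_law f m"
  using assms(1) by (intro has_bochner_integral_density) auto

lemma std_normal_law_mean: "has_bochner_integral std_normal_law (\<lambda>z. z) 0"
  using std_normal_moment_odd[of 0] by (intro has_bochner_integral_std_normal_law) auto

lemma std_normal_law_second_moment: "has_bochner_integral std_normal_law (\<lambda>z. z\<^sup>2) 1"
  using std_normal_moment_even[of 1]
  by (intro has_bochner_integral_std_normal_law) (auto simp: fact_numeral)

text \<open>After expanding the square, the cross term vanishes because the mean is 0, and the
  quadratic term has expectation \<open>\<sigma>\<^sup>2\<close>.\<close>

lemma std_normal_law_affine_second_moment: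
  "has_bochner_integral std_normal_law (\<lambda>z. (v + \<sigma> * z)\<^sup>2) (v\<^sup>2 + \<sigma>\<^sup>2)"
proof -
  interpret prob_space std_normal_law
    by (rule prob_space_normal_density) simp
  have "has_bochner_integral std_normal_law (\<lambda>z. v\<^sup>2) (v\<^sup>2)"
    using prob_space by (simp add: has_bochner_integral_iff)
  from has_bochner_integral_add[OF has_bochner_integral_add[OF this
        has_bochner_integral_mult_right[OF std_normal_law_mean, of "2 * v * \<sigma>"]]
        has_bochner_integral_mult_right[OF std_normal_law_second_moment, of "\<sigma>\<^sup>2"]]
  show ?thesis
    by (simp add: power2_sum power_mult_distrib algebra_simps)
qed

text \<open>Projecting a product measure to one coordinate returns the factor, so moments in several
  dimensions reduce to one. Using the image under scaling rather than a density keeps the degenerate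
  case \<sigma> = 0 included.\<close>

lemma isotropic_normal_component:
  fixes i :: "'n::finite"
  shows "distr (isotropic_normal \<sigma> :: (real ^ 'n) measure) borel (\<lambda>z. z $ i)
    = distr std_normal_law borel (\<lambda>z. \<sigma> * z)"
proof -
  let ?P = "\<Pi>\<^sub>M i\<in>(UNIV :: 'n set). std_normal_law"
  interpret D: prob_space std_normal_law
    by (rule prob_space_normal_density) simp
  have m: "(\<lambda>z. (\<chi> i. \<sigma> * z i) :: real ^ 'n) \<in> borel_measurable ?P"
  proof (subst borel_measurable_euclidean_space, rule ballI)
    fix b :: "real ^ 'n" assume "b \<in> Basis"
    then obtain j where "b = axis j 1"
      by (auto simp: Basis_vec_def)
    moreover have "(\<lambda>z. \<sigma> * z j) \<in> borel_measurable ?P"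
      by measurable
    ultimately show "(\<lambda>z. ((\<chi> i. \<sigma> * z i) :: real ^ 'n) \<bullet> b) \<in> borel_measurable ?P"
      by (simp add: inner_axis)
  qed
  have "distr (isotropic_normal \<sigma> :: (real ^ 'n) measure) borel (\<lambda>z. z $ i)
      = distr ?P borel (\<lambda>z. \<sigma> * z i)"
    unfolding isotropic_normal_def by (subst distr_distr[OF _ m]) (auto simp: comp_def)
  also have "\<dots> = distr (distr ?P std_normal_law (\<lambda>z. z i)) borel (\<lambda>z. \<sigma> * z)"
    by (subst distr_distr) (auto simp: comp_def)
  also have "distr ?P std_normal_law (\<lambda>z. z i) = std_normal_law"
    by (intro distr_PiM_component D.prob_space_axioms) auto
  finally show ?thesis .
qed

lemma isotropic_normal_component_mean:
  fixes i :: "'n::finite"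
  shows "has_bochner_integral (isotropic_normal \<sigma> :: (real ^ 'n) measure) (\<lambda>z. z $ i) 0"
proof -
  have "has_bochner_integral (distr (isotropic_normal \<sigma> :: (real ^ 'n) measure) borel (\<lambda>z. z $ i))
      (\<lambda>z. z) 0"
    unfolding isotropic_normal_component
    using has_bochner_integral_mult_right[OF std_normal_law_mean, of \<sigma>]
    by (intro has_bochner_integral_distr) auto
  then show ?thesis
    by (simp add: has_bochner_integral_iff integrable_distr_eq integral_distr)
qed

text \<open>The shift \<open>v\<close> lets one formula serve twice: \<open>v = 0\<close> gives the
  variance of the oracle, and general \<open>v\<close> the lower bound at a point where the
  deterministic part is not zero.\<close>

lemma isotropic_normal_component_second_moment:
  fixes i :: "'n::finite"
  shows "(\<integral>\<^sup>+z. ennreal ((v + z $ i)\<^sup>2) \<partial>(isotropic_normal \<sigma> :: (real ^ 'n) measure))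
    = ennreal (v\<^sup>2 + \<sigma>\<^sup>2)"
proof -
  have "(\<integral>\<^sup>+z. ennreal ((v + z $ i)\<^sup>2) \<partial>(isotropic_normal \<sigma> :: (real ^ 'n) measure))
      = (\<integral>\<^sup>+z. ennreal ((v + z)\<^sup>2) \<partial>distr (isotropic_normal \<sigma> :: (real ^ 'n) measure) borel (\<lambda>z. z $ i))"
    by (subst nn_integral_distr) auto
  also have "\<dots> = (\<integral>\<^sup>+z. ennreal ((v + \<sigma> * z)\<^sup>2) \<partial>std_normal_law)"
    unfolding isotropic_normal_component by (subst nn_integral_distr) auto
  also have "\<dots> = ennreal (v\<^sup>2 + \<sigma>\<^sup>2)"
    using std_normal_law_affine_second_moment[of v \<sigma>]
    by (simp add: has_bochner_integral_iff nn_integral_eq_integral)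
  finally show ?thesis .
qed

lemma isotropic_normal_mean:
  "has_bochner_integral (isotropic_normal \<sigma> :: (real ^ 'n::finite) measure) (\<lambda>z. z) 0"
proof -
  have "has_bochner_integral (isotropic_normal \<sigma> :: (real ^ 'n) measure)
      (\<lambda>z. \<Sum>i\<in>UNIV. (z $ i) *\<^sub>R (axis i 1 :: real ^ 'n)) (\<Sum>i\<in>UNIV. 0 *\<^sub>R (axis i 1 :: real ^ 'n))"
    by (intro has_bochner_integral_sum has_bochner_integral_scaleR_left
        isotropic_normal_component_mean)
  moreover have "(\<Sum>i\<in>UNIV. (z $ i) *\<^sub>R axis i 1) = z" for z :: "real ^ 'n"
    by (simp add: basis_expansion flip: scalar_mult_eq_scaleR)
  ultimately show ?thesis
    by simp
qed

lemma isotropic_normal_second_moment: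
  "(\<integral>\<^sup>+z. ennreal ((norm z)\<^sup>2) \<partial>(isotropic_normal \<sigma> :: (real ^ 'n::finite) measure))
    = ennreal (real CARD('n) * \<sigma>\<^sup>2)"
proof -
  have "(\<integral>\<^sup>+z. ennreal ((norm z)\<^sup>2) \<partial>(isotropic_normal \<sigma> :: (real ^ 'n) measure))
      = (\<integral>\<^sup>+z. (\<Sum>i\<in>UNIV. ennreal ((0 + z $ i)\<^sup>2)) \<partial>(isotropic_normal \<sigma> :: (real ^ 'n) measure))"
    by (intro nn_integral_cong)
      (simp add: power2_norm_eq_inner inner_vec_def sum_ennreal flip: power2_eq_square)
  also have "\<dots> = (\<Sum>i\<in>(UNIV :: 'n set). ennreal (\<sigma>\<^sup>2))"
    by (subst nn_integral_sum) (simp_all only: isotropic_normal_component_second_moment, auto)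
  finally show ?thesis
    by (simp add: ennreal_mult ennreal_of_nat_eq_real_of_nat)
qed

text \<open>A single coordinate already bounds the norm from below. The term from \<open>v\<close>
  will refute a uniform second moment bound, while \<open>\<sigma>\<^sup>2\<close> is the floor that
  no iterate can go below.\<close>

lemma isotropic_normal_shifted_second_moment_ge:
  fixes v :: "real ^ 'n::finite"
  shows "ennreal ((v $ i)\<^sup>2 + \<sigma>\<^sup>2) \<le> (\<integral>\<^sup>+z. ennreal ((norm (v + z))\<^sup>2) \<partial>isotropic_normal \<sigma>)"
proof -
  have "((v + z) $ i)\<^sup>2 \<le> (norm (v + z))\<^sup>2" for z
    using component_le_norm_cart[of "v + z" i] by (rule abs_le_square_iff[THEN iffD1, OF order_trans]) simp
  then show ?thesis
    unfolding isotropic_normal_component_second_moment[symmetric, where v = "v $ i" and i = i]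
    by (intro nn_integral_mono ennreal_leI) simp
qed

section \<open>Independence of the current iterate and the fresh noise\<close>

lemma (in prob_space) nn_integral_indep_var:
  assumes indep: "indep_var M1 Y M2 Z"
    and F: "case_prod F \<in> borel_measurable (M1 \<Otimes>\<^sub>M M2)"
  shows "(\<integral>\<^sup>+\<omega>. F (Y \<omega>) (Z \<omega>) \<partial>M) = (\<integral>\<^sup>+y. (\<integral>\<^sup>+z. F y z \<partial>distr M M2 Z) \<partial>distr M M1 Y)"
proof -
  have Y[measurable]: "random_variable M1 Y" and Z[measurable]: "random_variable M2 Z"
    using indep by (auto dest: indep_var_rv1 indep_var_rv2)
  \<comment> \<open>Tonelli's theorem below needs the law of \<open>Z\<close> to be sigma-finite.
    Independence makes the joint law the product of the marginals, so the inner integral runs over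
    \<open>Z\<close> with \<open>y\<close> frozen.\<close>
  interpret Z: prob_space "distr M M2 Z"
    by (rule prob_space_distr) fact
  have "(\<integral>\<^sup>+\<omega>. F (Y \<omega>) (Z \<omega>) \<partial>M)
      = (\<integral>\<^sup>+p. case_prod F p \<partial>distr M (M1 \<Otimes>\<^sub>M M2) (\<lambda>\<omega>. (Y \<omega>, Z \<omega>)))"
    using F by (subst nn_integral_distr) auto
  also have "\<dots> = (\<integral>\<^sup>+p. case_prod F p \<partial>(distr M M1 Y \<Otimes>\<^sub>M distr M M2 Z))"
    using indep by (simp add: indep_var_distribution_eq)
  also have "\<dots> = (\<integral>\<^sup>+y. (\<integral>\<^sup>+z. F y z \<partial>distr M M2 Z) \<partial>distr M M1 Y)"
    using F by (subst Z.nn_integral_fst[symmetric]) (auto cong: measurable_cong_sets)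
  finally show ?thesis .
qed

text \<open>With an affine oracle the closed form of the proximal step turns the algorithm into a
  linear recursion driven by the noise. Both measurability and the lower bound are read off from
  it.\<close>

lemma spdca_quadratic_Suc:
  fixes x0 :: "'a::real_inner"
  assumes "L \<ge> 0" and "\<gamma> t > 0"
  shows "spdca (\<lambda>x. L / 2 * (norm x)\<^sup>2) (\<lambda>x \<xi>. a *\<^sub>R x + \<xi>) \<gamma> x0 \<xi> (Suc t)
    = (1 / (L + 1 / \<gamma> t)) *\<^sub>R
        ((1 / \<gamma> t + a) *\<^sub>R spdca (\<lambda>x. L / 2 * (norm x)\<^sup>2) (\<lambda>x \<xi>. a *\<^sub>R x + \<xi>) \<gamma> x0 \<xi> t + \<xi> t)"
  by (simp only: spdca.simps Let_def arg_min_quadratic_subproblem[OF assms] scaleR_add_left add.assoc)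

text \<open>This expresses that the iterates are adapted: later noise values can be altered
  freely.\<close>

lemma spdca_cong:
  assumes "\<And>i. i < t \<Longrightarrow> \<xi> i = \<xi>' i"
  shows "spdca g G \<gamma> x0 \<xi> t = spdca g G \<gamma> x0 \<xi>' t"
  using assms by (induction t) auto

text \<open>The index set \<open>A\<close> may exceed the times that matter because the induction
  compares iterates \<open>t\<close> and \<open>Suc t\<close> on one and the same product
  space.\<close>

lemma spdca_quadratic_measurable:
  fixes x0 :: "'a::euclidean_space"
  assumes "L \<ge> 0" and "\<And>i. i < t \<Longrightarrow> \<gamma> i > 0" and "{..<t} \<subseteq> A"
    and [measurable_cong]: "sets N = sets borel"
  shows "(\<lambda>\<xi>. spdca (\<lambda>x. L / 2 * (norm x)\<^sup>2) (\<lambda>x \<xi>. a *\<^sub>R x + \<xi>) \<gamma> x0 \<xi> t)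
    \<in> borel_measurable (\<Pi>\<^sub>M i\<in>A. N)"
  using assms(2,3)
proof (induction t)
  case (Suc t)
  then have [measurable]:
      "(\<lambda>\<xi>. spdca (\<lambda>x. L / 2 * (norm x)\<^sup>2) (\<lambda>x \<xi>. a *\<^sub>R x + \<xi>) \<gamma> x0 \<xi> t) \<in> borel_measurable (\<Pi>\<^sub>M i\<in>A. N)"
    by (intro Suc.IH) auto
  have "t \<in> A"
    using Suc.prems by auto
  then have [measurable]: "(\<lambda>\<xi>. \<xi> t) \<in> borel_measurable (\<Pi>\<^sub>M i\<in>A. N)"
    using measurable_component_singleton[of t A "\<lambda>_. N"] by (simp cong: measurable_cong_sets add: assms)
  show ?case
    using Suc.prems \<open>L \<ge> 0\<close> by (simp only: spdca_quadratic_Suc lessI) measurable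
qed simp

text \<open>The iterate is a measurable function of the noise block \<open>{..<t}\<close>, which is
  disjoint from \<open>{t}\<close>. Disjoint blocks of an independent family are independent, and so
  are functions of them.\<close>

lemma spdca_quadratic_indep:
  fixes x0 :: "'a::euclidean_space"
  assumes "iid_sample \<Omega> N T \<xi>" and "sets N = sets borel" and "t < T"
    and "L \<ge> 0" and "\<And>i. i < t \<Longrightarrow> \<gamma> i > 0"
  shows "prob_space.indep_var \<Omega>
    borel (\<lambda>\<omega>. spdca (\<lambda>x. L / 2 * (norm x)\<^sup>2) (\<lambda>x \<xi>. a *\<^sub>R x + \<xi>) \<gamma> x0 (\<lambda>i. \<xi> i \<omega>) t)
    N (\<xi> t)"
proof -
  interpret prob_space \<Omega>
    using assms by (simp add: iid_sample_def)
  let ?S = "\<lambda>\<xi>. spdca (\<lambda>x. L / 2 * (norm x)\<^sup>2) (\<lambda>x \<xi>. a *\<^sub>R x + \<xi>) \<gamma> x0 \<xi> t"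
  have "indep_vars (\<lambda>_. N) \<xi> {..<T}"
    using assms by (simp add: iid_sample_def)
  then have "indep_var (\<Pi>\<^sub>M i\<in>{..<t}. N) (\<lambda>\<omega>. restrict (\<lambda>i. \<xi> i \<omega>) {..<t})
      (\<Pi>\<^sub>M i\<in>{t}. N) (\<lambda>\<omega>. restrict (\<lambda>i. \<xi> i \<omega>) {t})"
    using \<open>t < T\<close> by (intro indep_var_restrict) auto
  then have "indep_var borel (?S \<circ> (\<lambda>\<omega>. restrict (\<lambda>i. \<xi> i \<omega>) {..<t}))
      N ((\<lambda>w. w t) \<circ> (\<lambda>\<omega>. restrict (\<lambda>i. \<xi> i \<omega>) {t}))"
    by (rule indep_var_compose)
      (use assms in \<open>auto intro!: spdca_quadratic_measurable simp del: times_divide_eq_left\<close>)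
  \<comment> \<open>The restricted sequence takes the value \<open>undefined\<close> from index
    \<open>t\<close> on, and the iterate never reads those entries.\<close>
  moreover have "?S (restrict (\<lambda>i. \<xi> i \<omega>) {..<t}) = ?S (\<lambda>i. \<xi> i \<omega>)" for \<omega>
    by (rule spdca_cong) auto
  ultimately show ?thesis
    by (simp add: comp_def)
qed

section \<open>The witnesses, the oracle properties and the lower bound\<close>

theorem proposition3:
  fixes L \<sigma> :: real
    and g :: "real ^ 'n \<Rightarrow> real"
    and T :: nat
    and \<gamma> :: "nat \<Rightarrow> real"
  assumes "L \<ge> 0"
    and "g = (\<lambda>x. L / 2 * (norm x)\<^sup>2)"
    and "\<sigma> \<ge> 0"
    and "T \<ge> 1"
    and "\<forall>t<T. \<gamma> t > 0"
  shows "\<exists>(f :: real ^ 'n \<Rightarrow> real) (h :: real ^ 'n \<Rightarrow> real) (G :: real ^ 'n \<Rightarrow> real ^ 'n \<Rightarrow> real ^ 'n).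
    h = (\<lambda>x. (MAX k\<in>{..<T}. 2 * L + 1 / \<gamma> k) / 2 * (norm x)\<^sup>2) \<and>
    dc_decomposition f g h \<and>
    G = (\<lambda>x \<xi>. gradient h x + \<xi>) \<and>
    oracle_BV (isotropic_normal \<sigma>) G h \<and>
    \<not> oracle_BS (isotropic_normal \<sigma>) G h \<and>
    (\<forall>(\<Omega> :: 'w measure) (\<xi> :: nat \<Rightarrow> 'w \<Rightarrow> real ^ 'n) (x0 :: real ^ 'n).
       iid_sample \<Omega> (isotropic_normal \<sigma>) T \<xi> \<longrightarrow>
       (\<forall>k\<in>{1..T}.
          (\<integral>\<^sup>+\<omega>. ennreal ((norm (gradient f (spdca g G \<gamma> x0 (\<lambda>t. \<xi> t \<omega>) k)))\<^sup>2) \<partial>\<Omega>)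
            \<ge> ennreal (\<sigma>\<^sup>2)))"
proof -
  define a where "a = (MAX k\<in>{..<T}. 2 * L + 1 / \<gamma> k)"
  define h where "h = (\<lambda>x::real ^ 'n. a / 2 * (norm x)\<^sup>2)"
  define f where "f = (\<lambda>x. g x - h x)"
  \<comment> \<open>The gradient of \<open>h\<close> is written out explicitly, the form that the
    recursion for the iterates expects; \<open>grad_h\<close> identifies it afterwards.\<close>
  define G where "G = (\<lambda>x \<xi>::real ^ 'n. a *\<^sub>R x + \<xi>)"
  let ?N = "isotropic_normal \<sigma> :: (real ^ 'n) measure"
  interpret N: prob_space ?N
    by (rule prob_space_isotropic_normal)
  have a_ge: "2 * L + 1 / \<gamma> k \<le> a" if "k < T" for k
    using that unfolding a_def by (intro Max_ge) auto
  have a_pos: "a > 0"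
  proof -
    \<comment> \<open>Index 0 takes part in the maximum because \<open>T \<ge> 1\<close>.\<close>
    have "2 * L + 1 / \<gamma> 0 > 0"
      using assms by (intro add_nonneg_pos) auto
    also have "\<dots> \<le> a"
      using assms by (intro a_ge) auto
    finally show ?thesis .
  qed
  have grad_h: "gradient h = (\<lambda>x. a *\<^sub>R x)"
    unfolding h_def by (rule gradient_half_norm_sq)
  have f_eq: "f = (\<lambda>x. (L - a) / 2 * (norm x)\<^sup>2)"
    by (auto simp: f_def h_def assms algebra_simps diff_divide_distrib)
  have grad_f: "gradient f = (\<lambda>x. (L - a) *\<^sub>R x)"
    unfolding f_eq by (rule gradient_half_norm_sq)
  have dc: "dc_decomposition f g h"
    unfolding dc_decomposition_def f_def h_def \<open>g = _\<close>
    using \<open>L \<ge> 0\<close> a_pos by (intro conjI convex_on_half_norm_sq refl) simp_all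
  have "has_bochner_integral ?N (G x) (a *\<^sub>R x)" for x
  proof -
    have "has_bochner_integral ?N (\<lambda>\<xi>. a *\<^sub>R x) (a *\<^sub>R x)"
      using N.prob_space by (simp add: has_bochner_integral_iff)
    then show ?thesis
      using has_bochner_integral_add isotropic_normal_mean by (fastforce simp: G_def)
  qed
  then have unbiased: "unbiased_oracle ?N G h"
    by (auto simp: unbiased_oracle_def grad_h has_bochner_integral_iff)
  have BV: "oracle_BV ?N G h"
    unfolding oracle_BV_def
  \<comment> \<open>The oracle error is the noise itself, so the variance constant is the trace of
    its covariance matrix.\<close>
  proof (intro conjI unbiased exI[of _ "real CARD('n) * \<sigma>\<^sup>2"] allI)
    show "lipschitz_gradient h"
      unfolding h_def by (rule lipschitz_gradient_half_norm_sq)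
  qed (simp_all add: G_def grad_h isotropic_normal_second_moment)
  have not_BS: "\<not> oracle_BS ?N G h"
  proof
    assume "oracle_BS ?N G h"
    then obtain M where M: "M \<ge> 0"
        "\<And>x. (\<integral>\<^sup>+\<xi>. ennreal ((norm (G x \<xi>))\<^sup>2) \<partial>?N) \<le> ennreal (M\<^sup>2)"
      by (auto simp: oracle_BS_def)
    fix i :: 'n
    \<comment> \<open>The point is scaled so that the gradient of \<open>h\<close> there has
      \<open>i\<close>-th coordinate \<open>M + 1\<close>, just beyond the supposed bound. This
      works even for \<sigma> = 0.\<close>
    define x :: "real ^ 'n" where "x = axis i ((M + 1) / a)"
    have "ennreal ((M + 1)\<^sup>2 + \<sigma>\<^sup>2) \<le> ennreal (M\<^sup>2)"
      using isotropic_normal_shifted_second_moment_ge[of "a *\<^sub>R x" i \<sigma>] M(2)[of x] a_pos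
      by (simp add: G_def x_def)
    then have "(M + 1)\<^sup>2 + \<sigma>\<^sup>2 \<le> M\<^sup>2"
      by (rule ennreal_le_iff[THEN iffD1, rotated]) simp
    then show False
      using \<open>M \<ge> 0\<close> zero_le_power2[of \<sigma>] unfolding power2_sum by simp
  qed
  have lower: "ennreal (\<sigma>\<^sup>2)
      \<le> (\<integral>\<^sup>+\<omega>. ennreal ((norm (gradient f (spdca g G \<gamma> x0 (\<lambda>t. \<xi> t \<omega>) k)))\<^sup>2) \<partial>\<Omega>)"
    if iid: "iid_sample \<Omega> ?N T \<xi>" and k: "k \<in> {1..T}"
    for \<Omega> :: "'w measure" and \<xi> x0 k
  proof -
    \<comment> \<open>Since \<open>k \<ge> 1\<close>, a last step exists; its noise
      \<open>\<xi> t\<close> is independent of the iterate \<open>Y\<close> it starts from.\<close>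
    obtain t where t: "k = Suc t" "t < T"
      using k by (cases k) auto
    define p where "p = L + 1 / \<gamma> t"
    define c where "c = 1 / \<gamma> t + a"
    define Y where "Y = (\<lambda>\<omega>. spdca g G \<gamma> x0 (\<lambda>t. \<xi> t \<omega>) t)"
    \<comment> \<open>This is where the choice of \<open>a\<close> enters:
      \<open>a \<ge> 2 * L + 1 / \<gamma> t\<close> says exactly that \<open>a - L\<close> is at
      least \<open>p\<close>. The factor \<open>L - a\<close> in the gradient of \<open>f\<close>
      thus undoes the contraction by \<open>1 / p\<close>.\<close>
    have "p > 0" and p_le: "p \<le> a - L"
      using assms t a_ge[of t] by (auto simp: p_def intro: add_nonneg_pos)
    interpret prob_space \<Omega>
      using iid by (simp add: iid_sample_def)
    have indep: "indep_var borel Y ?N (\<xi> t)"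
      unfolding Y_def G_def \<open>g = _\<close> using iid t assms by (intro spdca_quadratic_indep) auto
    interpret Y: prob_space "distr \<Omega> borel Y"
      using indep by (intro prob_space_distr indep_var_rv1)
    have distr_\<xi>: "distr \<Omega> ?N (\<xi> t) = ?N"
      using iid t by (simp add: iid_sample_def)
    have "spdca g G \<gamma> x0 (\<lambda>t. \<xi> t \<omega>) k = (1 / p) *\<^sub>R (c *\<^sub>R Y \<omega> + \<xi> t \<omega>)" for \<omega>
      unfolding t Y_def G_def \<open>g = _\<close> p_def c_def using assms t
      by (intro spdca_quadratic_Suc) auto
    then have "norm (gradient f (spdca g G \<gamma> x0 (\<lambda>t. \<xi> t \<omega>) k))
        = (a - L) / p * norm (c *\<^sub>R Y \<omega> + \<xi> t \<omega>)" for \<omega>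
      using \<open>p > 0\<close> p_le by (simp add: grad_f)
    moreover have "1 * norm v \<le> (a - L) / p * norm v" for v :: "real ^ 'n"
      using \<open>p > 0\<close> p_le by (intro mult_right_mono) auto
    ultimately have step: "norm (c *\<^sub>R Y \<omega> + \<xi> t \<omega>)
        \<le> norm (gradient f (spdca g G \<gamma> x0 (\<lambda>t. \<xi> t \<omega>) k))" for \<omega>
      by simp
    \<comment> \<open>The constant is integrated against the law of \<open>Y\<close>, so that the
      bound can be applied for each frozen \<open>y\<close>, where \<open>c *\<^sub>R y\<close> acts
      as a deterministic shift of the noise. Independence then reassembles the double integral into
      an expectation over \<open>\<Omega>\<close>.\<close>
    have "ennreal (\<sigma>\<^sup>2) = (\<integral>\<^sup>+y. ennreal (\<sigma>\<^sup>2) \<partial>distr \<Omega> borel Y)"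
      using Y.emeasure_space_1 by simp
    also have "\<dots> \<le> (\<integral>\<^sup>+y. (\<integral>\<^sup>+z. ennreal ((norm (c *\<^sub>R y + z))\<^sup>2) \<partial>?N) \<partial>distr \<Omega> borel Y)"
      by (intro nn_integral_mono
          order_trans[OF _ isotropic_normal_shifted_second_moment_ge] ennreal_leI) auto
    also have "\<dots> = (\<integral>\<^sup>+\<omega>. ennreal ((norm (c *\<^sub>R Y \<omega> + \<xi> t \<omega>))\<^sup>2) \<partial>\<Omega>)"
      by (subst nn_integral_indep_var[OF indep]) (simp_all add: distr_\<xi>)
    also have "\<dots> \<le> (\<integral>\<^sup>+\<omega>. ennreal ((norm (gradient f (spdca g G \<gamma> x0 (\<lambda>t. \<xi> t \<omega>) k)))\<^sup>2) \<partial>\<Omega>)"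
      by (intro nn_integral_mono ennreal_leI power_mono step) auto
    finally show ?thesis .
  qed
  show ?thesis
  proof (rule exI[of _ f], rule exI[of _ h], rule exI[of _ G], intro conjI allI impI ballI)
    show "h = (\<lambda>x. (MAX k\<in>{..<T}. 2 * L + 1 / \<gamma> k) / 2 * (norm x)\<^sup>2)"
      by (simp only: h_def a_def)
    show "G = (\<lambda>x \<xi>. gradient h x + \<xi>)"
      by (simp add: G_def grad_h)
  qed (use dc BV not_BS lower in simp_all)
qed

end
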